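(* Let $k$ be an algebraically closed field of characteristic zero, let $I$ be any artinian graded ideal in $R=k[x,y]$, and let $\{h_i\}$ be the $h$-vector of $R/I$, $h_i=\dim_k[R/I]_i$. Fix any degree $i\ge1$. There exists a nonzero linear form $\ell\in R$ such that $\times\ell:[R/I]_{i-1}\to[R/I]_i$ fails to have maximal rank if and only if $[I]_i\neq 0$ and all forms of degree $i$ in $I$ have a common factor $F$ of positive degree. In that case the greatest common divisor $F$ of the forms in $[I]_i$ satisfies $\deg F\le h_i$.
   Context: $[M]_i$ denotes the degree $i$ component of a graded module $M$. A linear map has maximal rank if it is injective or surjective. *)

theory Defs
  imports "HOL-Algebra.Algebraic_Closure_Type"
begin

text \<open>
  The polynomial ring \<open>R = k[x,y]\<close> is the type \<^typ>\<open>'k poly poly\<close>, i.e. \<open>k[x][y]\<close>: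
  the coefficient of \<open>x\<^sup>a y\<^sup>b\<close> in \<open>p\<close> is \<^term>\<open>Polynomial.coeff (Polynomial.coeff p b) a\<close>.
\<close>

abbreviation kxy :: "'k::field poly poly ring"
  where "kxy \<equiv> ring_of_type_algebra"

definition forms :: "nat \<Rightarrow> 'k::field poly poly set"
  where "forms d = {p. \<forall>a b. Polynomial.coeff (Polynomial.coeff p b) a \<noteq> 0 \<longrightarrow> a + b = d}"

text \<open>Total degree in \<open>x\<close> and \<open>y\<close>; the zero polynomial has degree 0.\<close>

definition total_degree :: "'k::field poly poly \<Rightarrow> nat"
  where "total_degree p =
    Max (insert 0 {a + b | a b. Polynomial.coeff (Polynomial.coeff p b) a \<noteq> 0})"

definition graded_ideal :: "'k::field poly poly set \<Rightarrow> bool"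
  where "graded_ideal I \<longleftrightarrow> ideal I kxy \<and>
    (\<forall>f\<in>I. \<exists>g n. (\<forall>d. g d \<in> I \<inter> forms d) \<and> f = (\<Sum>d\<le>n. g d))"

definition artinian_ring :: "('a, 'b) ring_scheme \<Rightarrow> bool"
  where "artinian_ring A \<longleftrightarrow> ring A \<and>
    (\<forall>J :: nat \<Rightarrow> 'a set. (\<forall>n. ideal (J n) A) \<and> (\<forall>n. J (Suc n) \<subseteq> J n) \<longrightarrow>
      (\<exists>N. \<forall>n\<ge>N. J n = J N))"

text \<open>\<open>[R/I]\<^sub>d\<close>, as a set of cosets: the image of \<^term>\<open>forms d\<close> in \<open>R/I\<close>.\<close>

definition quot_component :: "'k::field poly poly set \<Rightarrow> nat \<Rightarrow> 'k poly poly set set"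
  where "quot_component I d = (\<lambda>p. I +>\<^bsub>kxy\<^esub> p) ` forms d"

text \<open>
  The image of the field \<open>k\<close> in \<open>R/I\<close>. Scalar multiplication by \<open>c \<in> k\<close> on \<open>R/I\<close> is
  multiplication by the coset of the constant \<open>c\<close>, so the \<open>k\<close>-dimension of a subspace of
  \<open>R/I\<close> is its dimension over this set in the sense of embedded algebras.
\<close>

definition quot_scalars :: "'k::field poly poly set \<Rightarrow> 'k poly poly set set"
  where "quot_scalars I = range (\<lambda>c. I +>\<^bsub>kxy\<^esub> [:[:c:]:])"

definition h_vector :: "'k::field poly poly set \<Rightarrow> nat \<Rightarrow> nat"
  where "h_vector I d = ring.dim (kxy Quot I) (quot_scalars I) (quot_component I d)"

definition mult_map ::
    "'k::field poly poly set \<Rightarrow> 'k poly poly \<Rightarrow> 'k poly poly set \<Rightarrow> 'k poly poly set"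
  where "mult_map I l C = (I +>\<^bsub>kxy\<^esub> l) \<otimes>\<^bsub>kxy Quot I\<^esub> C"

definition has_maximal_rank :: "('a \<Rightarrow> 'b) \<Rightarrow> 'a set \<Rightarrow> 'b set \<Rightarrow> bool"
  where "has_maximal_rank f V W \<longleftrightarrow> inj_on f V \<or> f ` V = W"

definition common_factor :: "'a::comm_semiring_1 \<Rightarrow> 'a set \<Rightarrow> bool"
  where "common_factor F S \<longleftrightarrow> (\<forall>f\<in>S. F dvd f)"

text \<open>A greatest common divisor, determined up to units.\<close>

definition is_gcd_of :: "'a::comm_semiring_1 \<Rightarrow> 'a set \<Rightarrow> bool"
  where "is_gcd_of F S \<longleftrightarrow> common_factor F S \<and> (\<forall>G. common_factor G S \<longrightarrow> G dvd F)"

end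

theory Submission
  imports Defs
begin

text \<open>
  Write \<open>R\<^sub>i\<close> for the forms of degree \<open>i\<close> and \<open>I\<^sub>i = I \<inter> R\<^sub>i\<close>. A nonzero linear form \<open>\<ell>\<close> in two
  variables has, up to scalars, a single zero \<open>(u, v)\<close>, and \<open>\<ell>\<close> divides a form exactly if the form
  vanishes there (\<open>line_through_dvd_form_iff\<close>). Hence \<open>\<ell> R\<^sub>i\<^sub>-\<^sub>1\<close> is a hyperplane of \<open>R\<^sub>i\<close>, and
  \<open>\<times>\<ell> : [R/I]\<^sub>i\<^sub>-\<^sub>1 \<rightarrow> [R/I]\<^sub>i\<close> is surjective unless \<open>I\<^sub>i\<close> lies in this hyperplane, that is, unless
  \<open>\<ell>\<close> divides all of \<open>I\<^sub>i\<close> (\<open>mult_map_surj_iff_line\<close>).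

  In that case injectivity fails as well, unless \<open>I\<^sub>i = 0\<close> (\<open>mult_map_not_inj\<close>). Injectivity would
  give \<open>I\<^sub>i = \<ell> I\<^sub>i\<^sub>-\<^sub>1\<close>. For a linear form \<open>m\<close> not proportional to \<open>\<ell>\<close> it follows that
  \<open>m I\<^sub>i\<^sub>-\<^sub>1 \<subseteq> \<ell> I\<^sub>i\<^sub>-\<^sub>1\<close>, so a power of \<open>\<ell>\<close> that divides all of \<open>I\<^sub>i\<^sub>-\<^sub>1\<close> can be raised by one, again
  and again, which is absurd for a nonzero form. Conversely, \<open>I\<^sub>i = 0\<close> makes every \<open>\<times>\<ell>\<close>
  injective. So maximal rank fails for some \<open>\<ell>\<close> exactly if \<open>I\<^sub>i \<noteq> 0\<close> has a common linear factor.
  Over an algebraically closed field this amounts to a common factor of positive degree, because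
  factors of forms are forms (\<open>factors_of_form\<close>) and a form of positive degree has a
  zero (\<open>form_has_zero\<close>).

  A greatest common divisor of \<open>I\<^sub>i\<close> is built by splitting off common linear factors
  (\<open>gcd_of_forms_exists\<close>). If \<open>F\<close> is a common factor of degree \<open>e\<close>, then \<open>I\<^sub>i \<subseteq> F R\<^sub>i\<^sub>-\<^sub>e\<close>, whose
  codimension in \<open>R\<^sub>i\<close> is \<open>(i + 1) - (i - e + 1) = e\<close>; so \<open>h\<^sub>i \<ge> e\<close>
  (\<open>common_factor_degree_le_h_vector\<close>).
\<close>


section \<open>Forms\<close>

lemma formsI:
  "(\<And>a b. Polynomial.coeff (Polynomial.coeff p b) a \<noteq> 0 \<Longrightarrow> a + b = d) \<Longrightarrow> p \<in> forms d"
  by (auto simp: forms_def)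

lemma formsD:
  "p \<in> forms d \<Longrightarrow> Polynomial.coeff (Polynomial.coeff p b) a \<noteq> 0 \<Longrightarrow> a + b = d"
  by (auto simp: forms_def)

lemma zero_in_forms: "0 \<in> forms d"
  by (simp add: forms_def)

lemma forms_add: "p \<in> forms d \<Longrightarrow> q \<in> forms d \<Longrightarrow> p + q \<in> forms d"
  unfolding forms_def coeff_add mem_Collect_eq by (metis add.right_neutral)

lemma forms_diff: "p \<in> forms d \<Longrightarrow> q \<in> forms d \<Longrightarrow> p - q \<in> forms d"
  unfolding forms_def coeff_diff mem_Collect_eq by (metis diff_0_right)

lemma forms_sum: "(\<And>i. i \<in> A \<Longrightarrow> f i \<in> forms d) \<Longrightarrow> sum f A \<in> forms d"
  by (induction A rule: infinite_finite_induct) (auto simp: zero_in_forms forms_add)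

lemma forms_mult:
  assumes "p \<in> forms d" "q \<in> forms e"
  shows "p * q \<in> forms (d + e)"
proof (rule formsI)
  fix a b
  assume "Polynomial.coeff (Polynomial.coeff (p * q) b) a \<noteq> 0"
  then have "(\<Sum>i\<le>b. Polynomial.coeff (Polynomial.coeff p i * Polynomial.coeff q (b - i)) a) \<noteq> 0"
    by (simp add: coeff_mult coeff_sum)
  then obtain i where i: "i \<le> b"
    "Polynomial.coeff (Polynomial.coeff p i * Polynomial.coeff q (b - i)) a \<noteq> 0"
    by (meson atMost_iff sum.neutral)
  then have "(\<Sum>j\<le>a. Polynomial.coeff (Polynomial.coeff p i) j
      * Polynomial.coeff (Polynomial.coeff q (b - i)) (a - j)) \<noteq> 0"
    by (simp add: coeff_mult)
  then obtain j where j: "j \<le> a" "Polynomial.coeff (Polynomial.coeff p i) j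
      * Polynomial.coeff (Polynomial.coeff q (b - i)) (a - j) \<noteq> 0"
    by (meson atMost_iff sum.neutral)
  then have "j + i = d" "(a - j) + (b - i) = e"
    using formsD[OF assms(1)] formsD[OF assms(2)] by auto
  with i j show "a + b = d + e" by linarith
qed

lemma monom_in_forms: "monom (monom c a) b \<in> forms (a + b)"
  by (rule formsI) (auto split: if_splits)

lemma const_in_forms: "[:[:c:]:] \<in> forms 0"
  using monom_in_forms[of c 0 0] by (simp add: monom_0)

lemma forms_degree_unique:
  assumes "p \<in> forms d" "p \<in> forms e" "p \<noteq> 0"
  shows "d = e"
proof -
  obtain b a where "Polynomial.coeff (Polynomial.coeff p b) a \<noteq> 0"
    using assms(3) by (metis coeff_0 poly_eqI)
  then show ?thesis using formsD[OF assms(1)] formsD[OF assms(2)] by metis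
qed

lemma coeff_form:
  assumes "p \<in> forms d" "b \<le> d"
  shows "Polynomial.coeff p b = monom (Polynomial.coeff (Polynomial.coeff p b) (d - b)) (d - b)"
  using formsD[OF assms(1)] assms(2) by (intro poly_eqI) (auto, fastforce)

lemma degree_form_le:
  assumes "p \<in> forms d"
  shows "Polynomial.degree p \<le> d"
proof (rule degree_le, intro allI impI)
  fix b assume "d < b"
  then show "Polynomial.coeff p b = 0"
    using formsD[OF assms] by (intro poly_eqI) (fastforce)
qed

lemma form_as_sum:
  assumes "p \<in> forms d"
  obtains c where "p = (\<Sum>b\<le>d. monom (monom (c b) (d - b)) b)"
proof
  have "p = (\<Sum>b\<le>d. monom (Polynomial.coeff p b) b)"
    using poly_as_sum_of_monoms'[OF degree_form_le[OF assms]] by simp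
  also have "\<dots> = (\<Sum>b\<le>d. monom (monom (Polynomial.coeff (Polynomial.coeff p b) (d - b)) (d - b)) b)"
    using coeff_form[OF assms] by (intro sum.cong) auto
  finally show "p = (\<Sum>b\<le>d. monom (monom (Polynomial.coeff (Polynomial.coeff p b) (d - b)) (d - b)) b)" .
qed

lemma forms_0_const:
  assumes "p \<in> forms 0"
  obtains c where "p = [:[:c:]:]"
  using form_as_sum[OF assms] by (auto simp: monom_0)

lemma total_degree_form:
  assumes "p \<in> forms d" "p \<noteq> 0"
  shows "total_degree p = d"
proof -
  obtain b a where "Polynomial.coeff (Polynomial.coeff p b) a \<noteq> 0"
    using assms(2) by (metis coeff_0 poly_eqI)
  then have "{a + b | a b. Polynomial.coeff (Polynomial.coeff p b) a \<noteq> 0} = {d}"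
    using formsD[OF assms(1)] by fastforce
  then show ?thesis by (simp add: total_degree_def)
qed


section \<open>Factors of forms are forms\<close>

text \<open>
  To see that a factorization of a form \<open>f\<close> consists of forms, a polynomial \<open>p(x, y)\<close> is replaced by
  \<open>p(x t, y t)\<close>. In the third variable \<open>t\<close>, a form of degree \<open>n\<close> becomes the monomial \<open>f t\<^sup>n\<close>, and
  over an integral domain the factors of a monomial are monomials. The substitution is never
  carried out: it is determined by having a form of degree \<open>d\<close> as its coefficient of
  \<open>t\<^sup>d\<close> and by giving back \<open>p\<close> at \<open>t = 1\<close>.
\<close>

lemma graded_lift_exists:
  fixes p :: "'k::field poly poly"
  shows "\<exists>P. (\<forall>d. Polynomial.coeff P d \<in> forms d) \<and> poly P 1 = p"
proof -
  define P where "P = (\<Sum>b\<le>Polynomial.degree p. \<Sum>a\<le>Polynomial.degree (Polynomial.coeff p b).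
     monom (monom (monom (Polynomial.coeff (Polynomial.coeff p b) a) a) b) (a + b))"
  have "Polynomial.coeff P d \<in> forms d" for d
    unfolding P_def coeff_sum by (intro forms_sum) (auto simp: zero_in_forms monom_in_forms)
  moreover have "poly P 1 = (\<Sum>b\<le>Polynomial.degree p. monom (\<Sum>a\<le>Polynomial.degree (Polynomial.coeff p b).
     monom (Polynomial.coeff (Polynomial.coeff p b) a) a) b)"
    unfolding P_def by (simp add: poly_sum poly_monom monom_sum)
  then have "poly P 1 = p"
    by (simp add: poly_as_sum_of_monoms)
  ultimately show ?thesis by blast
qed

text \<open>
  Monomials of different total degree cannot cancel at \<open>t = 1\<close>, so the coefficient of \<open>x\<^sup>a y\<^sup>b\<close>
  in \<open>P(1)\<close> is the one in the component of degree \<open>a + b\<close>.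
\<close>

lemma graded_lift_of_form:
  fixes P :: "'k::field poly poly poly"
  assumes P: "\<And>d. Polynomial.coeff P d \<in> forms d" and n: "poly P 1 \<in> forms n"
  shows "P = monom (poly P 1) n"
proof -
  have cf: "Polynomial.coeff (Polynomial.coeff (poly P 1) b) a
      = Polynomial.coeff (Polynomial.coeff (Polynomial.coeff P (a + b)) b) a" for a b
  proof -
    have "Polynomial.coeff (Polynomial.coeff (poly P 1) b) a
        = (\<Sum>i\<le>Polynomial.degree P. Polynomial.coeff (Polynomial.coeff (Polynomial.coeff P i) b) a)"
      by (simp add: poly_altdef coeff_sum)
    also have "\<dots> = (\<Sum>i\<in>{..Polynomial.degree P} \<inter> {a + b}.
        Polynomial.coeff (Polynomial.coeff (Polynomial.coeff P i) b) a)"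
      by (rule sum.mono_neutral_right) (auto dest: formsD[OF P])
    also have "\<dots> = Polynomial.coeff (Polynomial.coeff (Polynomial.coeff P (a + b)) b) a"
      by (cases "a + b \<le> Polynomial.degree P") (auto simp: coeff_eq_0)
    finally show ?thesis .
  qed
  have "Polynomial.coeff P d = (if d = n then poly P 1 else 0)" for d
  proof (intro poly_eqI)
    fix b a
    show "Polynomial.coeff (Polynomial.coeff (Polynomial.coeff P d) b) a
        = Polynomial.coeff (Polynomial.coeff (if d = n then poly P 1 else 0) b) a"
    proof (cases "a + b = d")
      case True
      then show ?thesis using cf[of b a] formsD[OF n, of b a] by auto
    next
      case False
      then show ?thesis using formsD[OF P, of d b a] formsD[OF n, of b a]
        by (metis coeff_0)
    qed
  qed
  then show ?thesis by (intro poly_eqI) auto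
qed

text \<open>
  A polynomial is a monomial as soon as its order at \<open>0\<close> equals its degree. The order is at most
  the degree, and both are additive on products.
\<close>

lemma factor_of_monom:
  fixes p q :: "'a::idom poly"
  assumes "p * q = monom c n" "c \<noteq> 0"
  shows "\<exists>a d. p = monom a d"
proof -
  have nz: "p * q \<noteq> 0" using assms by simp
  then have pq: "p \<noteq> 0" "q \<noteq> 0" by auto
  have deg: "Polynomial.degree p + Polynomial.degree q = n"
    using pq assms by (metis degree_mult_eq degree_monom_eq)
  have "order 0 (monom c n) = n"
    using assms(2) by (simp add: order_0_monom)
  then have ord: "order 0 p + order 0 q = n"
    using order_mult[OF nz, of 0] assms(1) by simp
  have "order 0 p = Polynomial.degree p"
    using ord deg order_degree[OF pq(1), of 0] order_degree[OF pq(2), of 0] by linarith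
  then have "[:0, 1:] ^ Polynomial.degree p dvd p"
    using order_1[of 0 p] by simp
  then obtain r where r: "p = monom 1 (Polynomial.degree p) * r"
    by (auto simp: monom_altdef elim: dvdE)
  then have "Polynomial.degree p = Polynomial.degree p + Polynomial.degree r"
    using pq(1) by (metis degree_monom_eq degree_mult_eq mult_not_zero one_neq_zero)
  then have "Polynomial.degree r = 0" by simp
  then obtain a where "r = [:a:]" by (rule degree_eq_zeroE)
  then have "monom 1 (Polynomial.degree p) * r = monom a (Polynomial.degree p)"
    by (simp add: mult_monom flip: monom_0)
  then show ?thesis using r by metis
qed

lemma factor_of_form:
  fixes p q :: "'k::field poly poly"
  assumes "p * q \<in> forms n" "p * q \<noteq> 0"
  shows "\<exists>d. p \<in> forms d"
proof -
  obtain P where P: "\<And>d. Polynomial.coeff P d \<in> forms d" "poly P 1 = p"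
    using graded_lift_exists by blast
  obtain Q where Q: "\<And>d. Polynomial.coeff Q d \<in> forms d" "poly Q 1 = q"
    using graded_lift_exists by blast
  have "Polynomial.coeff (P * Q) d \<in> forms d" for d
    unfolding coeff_mult using P(1) Q(1)
    by (intro forms_sum) (metis atMost_iff forms_mult le_add_diff_inverse)
  moreover have "poly (P * Q) 1 = p * q" by (simp add: P Q)
  ultimately have "P * Q = monom (p * q) n"
    using graded_lift_of_form[of "P * Q" n] assms(1) by simp
  then obtain a d where "P = monom a d"
    using factor_of_monom assms(2) by blast
  then have "p = a" "a \<in> forms d"
    using P(1)[of d] P(2) by (auto simp: poly_monom)
  then show ?thesis by blast
qed

lemma factors_of_form:
  fixes p q :: "'k::field poly poly"
  assumes "p * q \<in> forms n" "p * q \<noteq> 0"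
  obtains d e where "p \<in> forms d" "q \<in> forms e" "d + e = n"
proof -
  obtain d where d: "p \<in> forms d" using factor_of_form[OF assms] by blast
  obtain e where e: "q \<in> forms e" using factor_of_form[of q p n] assms by (auto simp: mult.commute)
  show thesis
    using that[OF d e] forms_degree_unique[OF forms_mult[OF d e] assms] by blast
qed

lemma quotient_of_forms:
  fixes p q :: "'k::field poly poly"
  assumes "p * q \<in> forms (d + e)" "p \<in> forms d" "p \<noteq> 0"
  shows "q \<in> forms e"
proof (cases "q = 0")
  case False
  then have "p * q \<noteq> 0" using assms(3) by simp
  then obtain d' e' where *: "p \<in> forms d'" "q \<in> forms e'" "d' + e' = d + e"
    using factors_of_form[OF assms(1)] by metis
  then have "d' = d" using forms_degree_unique assms(2,3) by blast
  then show ?thesis using * by simp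
qed (simp add: zero_in_forms)


section \<open>Zeros of forms and linear factors\<close>

definition eval_at :: "'k \<Rightarrow> 'k \<Rightarrow> 'k::field poly poly \<Rightarrow> 'k"
  where "eval_at u v p = poly (poly p [:v:]) u"

lemma eval_at_simps [simp]:
  "eval_at u v 0 = 0"
  "eval_at u v (p + q) = eval_at u v p + eval_at u v q"
  "eval_at u v (p - q) = eval_at u v p - eval_at u v q"
  "eval_at u v (p * q) = eval_at u v p * eval_at u v q"
  "eval_at u v (sum f A) = (\<Sum>x\<in>A. eval_at u v (f x))"
  "eval_at u v (monom (monom c a) b) = c * u ^ a * v ^ b"
  "eval_at u v (monom 1 b) = v ^ b"
  "eval_at u v [:[:c:]:] = c"
  by (simp_all add: eval_at_def poly_sum poly_monom poly_power)

text \<open>This is \<open>v x - u y\<close>; unless \<open>u = v = 0\<close>, its zeros are the multiples of \<open>(u, v)\<close>.\<close>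

definition line_through :: "'k \<Rightarrow> 'k \<Rightarrow> 'k::field poly poly"
  where "line_through u v = [:[:0, v:], [:- u:]:]"

lemma line_through_in_forms: "line_through u v \<in> forms 1"
proof -
  have "line_through u v = monom (monom v 1) 0 + monom (monom (- u) 0) 1"
    by (simp add: line_through_def monom_0 monom_Suc)
  then show ?thesis
    using forms_add[of "monom (monom v 1) 0" 1 "monom (monom (- u) 0) 1"]
      monom_in_forms[of v 1 0] monom_in_forms[of "- u" 0 1] by simp
qed

lemma line_through_eq_0_iff: "line_through u v = 0 \<longleftrightarrow> u = 0 \<and> v = 0"
  by (auto simp: line_through_def)

lemma linear_form_eq_line_through:
  assumes "l \<in> forms 1"
  obtains u v where "l = line_through u v"
proof -
  obtain c where "l = (\<Sum>b\<le>1. monom (monom (c b) (1 - b)) b)"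
    using form_as_sum[OF assms] .
  also have "\<dots> = line_through (- c 1) (c 0)"
    by (simp add: line_through_def monom_0 monom_Suc)
  finally show thesis by (rule that)
qed

lemma eval_at_line_through: "eval_at u v (line_through s t) = t * u - s * v"
  by (simp add: eval_at_def line_through_def algebra_simps)

text \<open>
  Modulo \<open>v x - u y\<close>, a nonzero scalar multiple of the generic point \<open>(x, y)\<close> becomes a
  multiple \<open>t (u, v)\<close>. By homogeneity a nonzero scalar multiple of \<open>p(x, y)\<close> is then congruent
  to \<open>t\<^sup>d p(u, v) = 0\<close>.
\<close>

lemma line_through_dvd_form:
  assumes "p \<in> forms d" "eval_at u v p = 0" "u \<noteq> 0 \<or> v \<noteq> 0"
  shows "line_through u v dvd p"
proof -
  obtain c where c: "p = (\<Sum>b\<le>d. monom (monom (c b) (d - b)) b)"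
    using form_as_sum[OF assms(1)] .
  define x :: "'a poly poly" where "x = [:[:0, 1:]:]"
  define y :: "'a poly poly" where "y = [:0, [:1:]:]"
  define C :: "'a \<Rightarrow> 'a poly poly" where "C = (\<lambda>a. [:[:a:]:])"
  have mon: "monom (monom a i) j = C a * x ^ i * y ^ j" for a i j
  proof -
    have "x ^ i = [:monom 1 i:]"
      by (induction i) (simp_all add: x_def monom_0 monom_Suc pCons_one)
    moreover have "y ^ j = monom 1 j"
      by (simp only: y_def monom_altdef smult_1_left pCons_one)
    ultimately show ?thesis by (simp add: C_def smult_monom)
  qed
  have Cm: "C (a * b) = C a * C b" for a b
    by (simp add: C_def)
  have Cp: "C (a ^ n) = C a ^ n" for a n
    by (induction n) (simp_all add: Cm, simp add: C_def pCons_one)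
  have C0: "C 0 = 0" and Ca: "C (a + b) = C a + C b" for a b
    by (simp_all add: C_def)
  have Csum: "C (sum f A) = (\<Sum>b\<in>A. C (f b))" for f and A :: "nat set"
    by (induction A rule: infinite_finite_induct) (simp_all add: C0 Ca)
  have p: "p = (\<Sum>b\<le>d. C (c b) * x ^ (d - b) * y ^ b)"
    using c by (simp add: mon)
  have ev: "eval_at u v p = (\<Sum>b\<le>d. c b * u ^ (d - b) * v ^ b)"
    unfolding c by simp
  have L: "line_through u v = C v * x - C u * y"
    by (simp add: line_through_def C_def x_def y_def)
  \<comment> \<open>Take \<open>(w, t) = (u, x)\<close> or \<open>(w, t) = (v, y)\<close>, whichever makes \<open>w\<close> nonzero.\<close>
  obtain w t where w: "w \<noteq> 0"
    and x: "line_through u v dvd C w * x - C u * t" and y: "line_through u v dvd C w * y - C v * t"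
  proof (cases "u = 0")
    case False
    have "C u * y - C v * x = - line_through u v" by (simp add: L)
    then show thesis using that[of u x] False by simp
  next
    case True
    have "line_through u v dvd C v * x - C u * y" by (simp add: L)
    then show thesis using that[of v y] True assms(3) by simp
  qed
  have pw: "line_through u v dvd A ^ i * B ^ j - A' ^ i * B' ^ j"
    if "line_through u v dvd A - A'" "line_through u v dvd B - B'" for A A' B B' :: "'a poly poly" and i j
  proof -
    have "line_through u v dvd A ^ i - A' ^ i" "line_through u v dvd B ^ j - B' ^ j"
      using that by (auto simp: power_diff_sumr2)
    then have "line_through u v dvd A ^ i * (B ^ j - B' ^ j) + (A ^ i - A' ^ i) * B' ^ j"
      by simp
    then show ?thesis by (simp add: algebra_simps)
  qed
  have "C (w ^ d) * p = (\<Sum>b\<le>d. C (c b) * ((C w * x) ^ (d - b) * (C w * y) ^ b))"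
    unfolding p sum_distrib_left Cp
  proof (intro sum.cong refl)
    fix b assume "b \<in> {..d}"
    then have "C w ^ d = C w ^ (d - b) * C w ^ b" by (simp flip: power_add)
    then show "C w ^ d * (C (c b) * x ^ (d - b) * y ^ b) = C (c b) * ((C w * x) ^ (d - b) * (C w * y) ^ b)"
      by (simp add: power_mult_distrib algebra_simps)
  qed
  moreover have "0 = (\<Sum>b\<le>d. C (c b) * ((C u * t) ^ (d - b) * (C v * t) ^ b))"
  proof -
    have "0 = t ^ d * C (\<Sum>b\<le>d. c b * u ^ (d - b) * v ^ b)"
      using assms(2) ev by (simp add: C_def)
    also have "\<dots> = (\<Sum>b\<le>d. t ^ d * (C (c b) * C u ^ (d - b) * C v ^ b))"
      by (simp add: Csum Cp Cm sum_distrib_left)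
    also have "\<dots> = (\<Sum>b\<le>d. C (c b) * ((C u * t) ^ (d - b) * (C v * t) ^ b))"
    proof (intro sum.cong refl)
      fix b assume "b \<in> {..d}"
      then have "t ^ d = t ^ (d - b) * t ^ b" by (simp flip: power_add)
      then show "t ^ d * (C (c b) * C u ^ (d - b) * C v ^ b) = C (c b) * ((C u * t) ^ (d - b) * (C v * t) ^ b)"
        by (simp add: power_mult_distrib algebra_simps)
    qed
    finally show ?thesis .
  qed
  ultimately have "C (w ^ d) * p = (\<Sum>b\<le>d. C (c b) * ((C w * x) ^ (d - b) * (C w * y) ^ b
      - (C u * t) ^ (d - b) * (C v * t) ^ b))"
    by (simp add: right_diff_distrib sum_subtractf)
  also have "line_through u v dvd \<dots>"
    by (intro dvd_sum dvd_mult pw x y)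
  finally have "line_through u v dvd C (inverse (w ^ d)) * (C (w ^ d) * p)"
    by (rule dvd_mult)
  moreover have "C (inverse (w ^ d)) * (C (w ^ d) * p) = p"
    using w by (simp add: C_def pCons_one flip: mult.assoc)
  ultimately show ?thesis by simp
qed

lemma line_through_dvd_form_iff:
  assumes "p \<in> forms d" "u \<noteq> 0 \<or> v \<noteq> 0"
  shows "line_through u v dvd p \<longleftrightarrow> eval_at u v p = 0"
proof
  assume "line_through u v dvd p"
  then show "eval_at u v p = 0" by (auto simp: eval_at_line_through)
qed (rule line_through_dvd_form[OF assms(1) _ assms(2)])

text \<open>
  Unless the form vanishes at the point \<open>(0, 1)\<close>, setting \<open>x = 1\<close> leaves a univariate polynomial
  of the full degree \<open>d\<close>, which has a root.
\<close>

lemma form_has_zero: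
  fixes p :: "'k::alg_closed_field poly poly"
  assumes "p \<in> forms d" "d > 0"
  obtains u v where "u \<noteq> 0 \<or> v \<noteq> 0" "eval_at u v p = 0"
proof -
  obtain c where c: "p = (\<Sum>b\<le>d. monom (monom (c b) (d - b)) b)"
    using form_as_sum[OF assms(1)] .
  have ev: "eval_at u v p = (\<Sum>b\<le>d. c b * u ^ (d - b) * v ^ b)" for u v
    unfolding c by simp
  show thesis
  proof (cases "c d = 0")
    case True
    have "c b * 0 ^ (d - b) * 1 ^ b = 0" if "b \<in> {..d}" for b
      using that True by (cases "b = d") auto
    then have "eval_at 0 1 p = 0"
      unfolding ev by (intro sum.neutral) blast
    then show thesis using that[of 0 1] by simp
  next
    case False
    then obtain x where "(\<Sum>b\<le>d. c b * x ^ b) = 0"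
      using alg_closed[of d c] assms(2) by blast
    then have "eval_at 1 x p = 0" unfolding ev by simp
    then show thesis using that[of 1 x] by simp
  qed
qed

lemma line_through_dvd_obtains:
  assumes "p \<in> forms (Suc d)" "u \<noteq> 0 \<or> v \<noteq> 0" "eval_at u v p = 0"
  obtains h where "h \<in> forms d" "p = line_through u v * h"
proof -
  obtain h where h: "p = line_through u v * h"
    using line_through_dvd_form[OF assms(1,3,2)] by (rule dvdE)
  moreover have "h \<in> forms d"
    using quotient_of_forms[of "line_through u v" h 1 d] assms(1,2) h line_through_eq_0_iff[of u v]
    by (metis line_through_in_forms plus_1_eq_Suc)
  ultimately show thesis using that by blast
qed

text \<open>
  A linear form acts as a prime among forms: divisibility by it is vanishing at a point, and
  evaluation is multiplicative.
\<close>

lemma line_through_power_dvd_cancel: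
  assumes uv: "u \<noteq> 0 \<or> v \<noteq> 0" and m: "m \<in> forms e" "eval_at u v m \<noteq> 0"
  shows "g \<in> forms d \<Longrightarrow> line_through u v ^ n dvd m * g \<Longrightarrow> line_through u v ^ n dvd g"
proof (induction n arbitrary: g d)
  case (Suc n)
  have nz: "line_through u v \<noteq> 0" using uv by (auto simp: line_through_eq_0_iff)
  have "line_through u v dvd m * g"
    using Suc.prems(2) dvd_trans[of "line_through u v" "line_through u v ^ Suc n"] by simp
  then have ev: "eval_at u v g = 0"
    using line_through_dvd_form_iff[OF forms_mult[OF m(1) Suc.prems(1)] uv] m(2) by simp
  then obtain h where h: "g = line_through u v * h"
    using line_through_dvd_form[OF Suc.prems(1) _ uv] by (auto elim: dvdE)
  show ?case
  proof (cases "g = 0")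
    case False
    then obtain e' where "h \<in> forms e'"
      using factors_of_form[of "line_through u v" h d] Suc.prems(1) h by metis
    moreover have "line_through u v * line_through u v ^ n dvd line_through u v * (m * h)"
      using Suc.prems(2) by (simp add: h algebra_simps)
    then have "line_through u v ^ n dvd m * h" using nz by simp
    ultimately have "line_through u v ^ n dvd h" by (rule Suc.IH)
    then show ?thesis by (simp add: h)
  qed simp
qed simp

lemma factor_of_form_total_degree:
  assumes "F dvd f" "f \<in> forms i" "f \<noteq> 0"
  shows "F \<in> forms (total_degree F)" "total_degree F \<le> i"
proof -
  obtain g where g: "f = F * g" using assms(1) by (rule dvdE)
  then obtain d e where *: "F \<in> forms d" "d + e = i"
    using factors_of_form[of F g i] assms by metis
  moreover have "F \<noteq> 0" using g assms(3) by auto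
  ultimately show "F \<in> forms (total_degree F)" "total_degree F \<le> i"
    using total_degree_form by fastforce+
qed


section \<open>Greatest common divisors of forms\<close>

text \<open>
  If the members of \<open>S\<close> have a common zero other than the origin, they have a common linear factor \<open>L\<close>, and a greatest
  common divisor of the quotients, multiplied by \<open>L\<close>, is one for \<open>S\<close>. If they have no such
  zero, no common factor has one either, so a common factor is a form of degree \<open>0\<close>.
\<close>

lemma gcd_of_forms_exists:
  fixes S :: "'k::alg_closed_field poly poly set"
  assumes "S \<subseteq> forms i" "\<not> S \<subseteq> {0}"
  shows "\<exists>F. is_gcd_of F S"
  using assms
proof (induction i arbitrary: S)
  case 0
  then obtain s where s: "s \<in> S" "s \<noteq> 0" by auto
  then obtain c where c: "s = [:[:c:]:]"
    using 0 forms_0_const[of s] by auto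
  then have "s dvd 1"
    using s(2) by (intro dvdI[of _ _ "[:[:inverse c:]:]"]) (simp add: pCons_one)
  then have "G dvd 1" if "common_factor G S" for G
    using that s(1) by (auto simp: common_factor_def intro: dvd_trans)
  then have "is_gcd_of 1 S" by (simp add: is_gcd_of_def common_factor_def)
  then show ?case by blast
next
  case (Suc i)
  obtain s where s: "s \<in> S" "s \<noteq> 0" using Suc.prems(2) by auto
  have sf: "s \<in> forms (Suc i)" using s Suc.prems(1) by blast
  show ?case
  proof (cases "\<exists>u v. (u \<noteq> 0 \<or> v \<noteq> 0) \<and> (\<forall>f\<in>S. eval_at u v f = 0)")
    case False
    have "G dvd 1" if G: "common_factor G S" for G
    proof -
      have Gs: "G dvd s" using G s(1) by (simp add: common_factor_def)
      then have Gf: "G \<in> forms (total_degree G)"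
        using factor_of_form_total_degree[OF _ sf s(2)] by blast
      have "total_degree G = 0"
      proof (rule ccontr)
        assume "total_degree G \<noteq> 0"
        then obtain u v where uv: "u \<noteq> 0 \<or> v \<noteq> 0" "eval_at u v G = 0"
          using form_has_zero[OF Gf] by auto
        have "eval_at u v f = 0" if "f \<in> S" for f
        proof -
          have "G dvd f" using G that by (simp add: common_factor_def)
          then show ?thesis using uv(2) by auto
        qed
        then show False using False uv(1) by blast
      qed
      then obtain c where c: "G = [:[:c:]:]"
        using forms_0_const[of G] Gf by auto
      moreover have "c \<noteq> 0" using c Gs s(2) by auto
      ultimately show ?thesis
        by (intro dvdI[of _ _ "[:[:inverse c:]:]"]) (simp add: pCons_one)
    qed
    then have "is_gcd_of 1 S" by (simp add: is_gcd_of_def common_factor_def)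
    then show ?thesis by blast
  next
    case True
    then obtain u v where uv: "u \<noteq> 0 \<or> v \<noteq> 0" and van: "\<And>f. f \<in> S \<Longrightarrow> eval_at u v f = 0"
      by blast
    let ?L = "line_through u v"
    have L0: "?L \<noteq> 0" using uv by (auto simp: line_through_eq_0_iff)
    define T where "T = {h \<in> forms i. ?L * h \<in> S}"
    have S: "\<exists>h\<in>T. f = ?L * h" if f: "f \<in> S" for f
    proof -
      obtain h where "h \<in> forms i" "f = ?L * h"
        using line_through_dvd_obtains[OF subsetD[OF Suc.prems(1) f] uv van[OF f]] by blast
      then show ?thesis using f by (auto simp: T_def)
    qed
    have "\<not> T \<subseteq> {0}" using S[OF s(1)] s(2) by auto
    then obtain F where F: "is_gcd_of F T"
      using Suc.IH[of T] by (auto simp: T_def)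
    have "G dvd ?L * F" if G: "common_factor G S" for G
    proof -
      have Gs: "G dvd s" using G s(1) by (simp add: common_factor_def)
      then have Gf: "G \<in> forms (total_degree G)"
        using factor_of_form_total_degree[OF _ sf s(2)] by blast
      show ?thesis
      proof (cases "eval_at u v G = 0")
        \<comment> \<open>Here \<open>L\<close> divides \<open>G\<close> and can be cancelled from both.\<close>
        case True
        then obtain G' where G': "G = ?L * G'"
          using line_through_dvd_form[OF Gf _ uv] by (auto elim: dvdE)
        have "G' dvd h" if "h \<in> T" for h
        proof -
          have "?L * G' dvd ?L * h"
            using G that by (auto simp: common_factor_def T_def G')
          then show ?thesis using L0 by simp
        qed
        then have "G' dvd F" using F by (simp add: is_gcd_of_def common_factor_def)
        then show ?thesis by (simp add: G')
      next
        \<comment> \<open>Here \<open>L\<close> is prime to \<open>G\<close>, so \<open>G\<close> already divides the quotients by \<open>L\<close>.\<close>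
        case False
        have "G dvd h" if h: "h \<in> T" for h
        proof (cases "h = 0")
          case h0: False
          have Lh: "?L * h \<in> S" "?L * h \<noteq> 0" using h h0 L0 by (auto simp: T_def)
          then obtain k where k: "?L * h = G * k"
            using G by (auto simp: common_factor_def elim: dvdE)
          then obtain e where kf: "k \<in> forms e"
            using factors_of_form[of G k "Suc i"] Lh Suc.prems(1) by (metis subsetD)
          have "eval_at u v (G * k) = 0" using van[OF Lh(1)] k by simp
          then have "eval_at u v k = 0" using False by simp
          then obtain k' where "k = ?L * k'"
            using line_through_dvd_form[OF kf _ uv] by (auto elim: dvdE)
          then have "?L * h = ?L * (G * k')" using k by (simp add: algebra_simps)
          then have "h = G * k'" using L0 by simp
          then show ?thesis by simp
        qed simp
        then have "G dvd F" using F by (simp add: is_gcd_of_def common_factor_def)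
        then show ?thesis by simp
      qed
    qed
    moreover have "?L * F dvd f" if "f \<in> S" for f
      using S[OF that] F by (auto simp: is_gcd_of_def common_factor_def)
    ultimately have "is_gcd_of (?L * F) S" by (simp add: is_gcd_of_def common_factor_def)
    then show ?thesis by blast
  qed
qed


section \<open>Graded ideals and multiplication by a linear form\<close>

lemma kxy_simps [simp]:
  "carrier kxy = UNIV" "a \<otimes>\<^bsub>kxy\<^esub> b = a * b" "\<one>\<^bsub>kxy\<^esub> = 1" "\<zero>\<^bsub>kxy\<^esub> = 0" "a \<oplus>\<^bsub>kxy\<^esub> b = a + b"
  by (simp_all add: ring_of_type_algebra_def)

lemma cring_kxy: "cring kxy"
  by (rule cring_from_type_algebra)

lemma ring_kxy: "ring kxy"
  by (rule ring_from_type_algebra)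

lemma minus_kxy [simp]: "a \<ominus>\<^bsub>kxy\<^esub> b = a - b"
proof -
  interpret cring kxy by (rule cring_kxy)
  have "\<ominus>\<^bsub>kxy\<^esub> b + b = 0" using l_neg[of b] by simp
  then have "\<ominus>\<^bsub>kxy\<^esub> b = - b" by (simp add: eq_neg_iff_add_eq_0)
  then show ?thesis by (simp add: minus_eq)
qed

context
  fixes I :: "'k::field poly poly set"
  assumes I: "ideal I kxy"
begin

lemma ideal_closed:
  "0 \<in> I" "a \<in> I \<Longrightarrow> b \<in> I \<Longrightarrow> a + b \<in> I" "a \<in> I \<Longrightarrow> r * a \<in> I"
  using additive_subgroup.zero_closed[OF ideal.axioms(1)[OF I]]
    additive_subgroup.a_closed[OF ideal.axioms(1)[OF I], of a b]
    ideal.I_l_closed[OF I, of a r] by simp_all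

lemma coset_eq_iff: "I +>\<^bsub>kxy\<^esub> a = I +>\<^bsub>kxy\<^esub> b \<longleftrightarrow> a - b \<in> I"
  using ring.quotient_eq_iff_same_a_r_cos[OF ring_kxy I, of a b] by simp

lemma mult_map_coset: "mult_map I l (I +>\<^bsub>kxy\<^esub> p) = I +>\<^bsub>kxy\<^esub> (l * p)"
  using ideal.rcoset_mult_add[OF I, of l p] by (simp add: mult_map_def FactRing_def)

lemma mult_map_inj_iff:
  "inj_on (mult_map I l) (quot_component I d) \<longleftrightarrow> (\<forall>f\<in>forms d. l * f \<in> I \<longrightarrow> f \<in> I)"
proof
  assume inj: "inj_on (mult_map I l) (quot_component I d)"
  show "\<forall>f\<in>forms d. l * f \<in> I \<longrightarrow> f \<in> I"
  proof (intro ballI impI)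
    fix f assume f: "f \<in> forms d" "l * f \<in> I"
    then have "mult_map I l (I +>\<^bsub>kxy\<^esub> f) = mult_map I l (I +>\<^bsub>kxy\<^esub> 0)"
      by (simp add: mult_map_coset coset_eq_iff)
    then have "I +>\<^bsub>kxy\<^esub> f = I +>\<^bsub>kxy\<^esub> 0"
      using inj f(1) zero_in_forms by (auto simp: quot_component_def dest: inj_onD)
    then show "f \<in> I" by (simp add: coset_eq_iff)
  qed
next
  assume *: "\<forall>f\<in>forms d. l * f \<in> I \<longrightarrow> f \<in> I"
  show "inj_on (mult_map I l) (quot_component I d)"
  proof (rule inj_onI)
    fix x y assume "x \<in> quot_component I d" "y \<in> quot_component I d"
      and eq: "mult_map I l x = mult_map I l y"
    then obtain f g where fg: "f \<in> forms d" "g \<in> forms d"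
      "x = I +>\<^bsub>kxy\<^esub> f" "y = I +>\<^bsub>kxy\<^esub> g" by (auto simp: quot_component_def)
    then have "l * (f - g) \<in> I"
      using eq by (simp add: mult_map_coset coset_eq_iff right_diff_distrib)
    then show "x = y" using * fg forms_diff by (auto simp: coset_eq_iff)
  qed
qed

lemma mult_map_surj_iff:
  assumes "l \<in> forms 1"
  shows "mult_map I l ` quot_component I d = quot_component I (Suc d)
    \<longleftrightarrow> (\<forall>g\<in>forms (Suc d). \<exists>f\<in>forms d. g - l * f \<in> I)"
proof -
  have im: "mult_map I l ` quot_component I d = (\<lambda>f. I +>\<^bsub>kxy\<^esub> (l * f)) ` forms d"
    by (simp add: quot_component_def image_image mult_map_coset)
  also have "\<dots> \<subseteq> quot_component I (Suc d)"
    using forms_mult[OF assms] by (fastforce simp: quot_component_def)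
  finally have "mult_map I l ` quot_component I d = quot_component I (Suc d)
      \<longleftrightarrow> quot_component I (Suc d) \<subseteq> mult_map I l ` quot_component I d" by blast
  also have "\<dots> \<longleftrightarrow> (\<forall>g\<in>forms (Suc d). \<exists>f\<in>forms d. I +>\<^bsub>kxy\<^esub> g = I +>\<^bsub>kxy\<^esub> (l * f))"
    unfolding im by (auto simp: quot_component_def)
  finally show ?thesis by (simp add: coset_eq_iff)
qed

text \<open>
  The image of \<open>\<times>\<ell>\<close> contains the classes of all forms that vanish at \<open>(u, v)\<close>, a hyperplane.
  It is everything as soon as some form of this degree in \<open>I\<close> does not vanish at \<open>(u, v)\<close>, because
  subtracting a multiple of that form moves any form into the hyperplane without changing its
  class. Otherwise vanishing at \<open>(u, v)\<close> depends only on the class, and the classes in the image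
  are those that vanish.
\<close>

lemma mult_map_surj_iff_line:
  assumes "u \<noteq> 0 \<or> v \<noteq> 0"
  shows "mult_map I (line_through u v) ` quot_component I d = quot_component I (Suc d)
    \<longleftrightarrow> \<not> common_factor (line_through u v) (I \<inter> forms (Suc d))"
  unfolding mult_map_surj_iff[OF line_through_in_forms]
proof
  assume *: "\<forall>g\<in>forms (Suc d). \<exists>f\<in>forms d. g - line_through u v * f \<in> I"
  have "\<exists>g\<in>forms (Suc d). eval_at u v g \<noteq> 0"
  proof (cases "u = 0")
    case True
    then show ?thesis using assms monom_in_forms[of 1 0 "Suc d"]
      by (intro bexI[of _ "monom (monom 1 0) (Suc d)"]) simp_all
  next
    case False
    then show ?thesis using monom_in_forms[of 1 "Suc d" 0]
      by (intro bexI[of _ "monom (monom 1 (Suc d)) 0"]) simp_all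
  qed
  then obtain g where g: "g \<in> forms (Suc d)" "eval_at u v g \<noteq> 0" by blast
  then obtain f where f: "f \<in> forms d" "g - line_through u v * f \<in> I" using * by blast
  have gf: "g - line_through u v * f \<in> forms (Suc d)"
    using forms_diff[OF g(1)] forms_mult[OF line_through_in_forms f(1)] by simp
  have "eval_at u v (g - line_through u v * f) \<noteq> 0"
    using g(2) by (simp add: eval_at_line_through)
  then show "\<not> common_factor (line_through u v) (I \<inter> forms (Suc d))"
    using line_through_dvd_form_iff[OF gf assms] f(2) gf by (auto simp: common_factor_def)
next
  assume "\<not> common_factor (line_through u v) (I \<inter> forms (Suc d))"
  then obtain g where g: "g \<in> I" "g \<in> forms (Suc d)" "eval_at u v g \<noteq> 0"
    using line_through_dvd_form_iff[OF _ assms] by (auto simp: common_factor_def)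
  show "\<forall>h\<in>forms (Suc d). \<exists>f\<in>forms d. h - line_through u v * f \<in> I"
  proof
    fix h :: "'k poly poly" assume h: "h \<in> forms (Suc d)"
    define c where "c = [:[:eval_at u v h / eval_at u v g:]:]"
    have cg: "c * g \<in> forms (Suc d)"
      using forms_mult[OF const_in_forms g(2)] by (simp add: c_def)
    have "eval_at u v c = eval_at u v h / eval_at u v g" by (simp add: c_def)
    then have "eval_at u v (h - c * g) = 0" using g(3) by simp
    then obtain f where "f \<in> forms d" "h - c * g = line_through u v * f"
      using line_through_dvd_obtains[OF forms_diff[OF h cg] assms] by blast
    moreover from this have "h - line_through u v * f = c * g" by (simp add: algebra_simps)
    ultimately show "\<exists>f\<in>forms d. h - line_through u v * f \<in> I"
      using ideal_closed(3)[OF g(1), of c] by metis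
  qed
qed

text \<open>
  Were \<open>\<times>\<ell>\<close> injective, then \<open>I\<^sub>d\<^sub>+\<^sub>1 = \<ell> I\<^sub>d\<close>. For a linear form \<open>m\<close> that does not vanish at \<open>(u, v)\<close>
  and \<open>g \<in> I\<^sub>d\<close> one can write \<open>m g = \<ell> f\<close> with \<open>f \<in> I\<^sub>d\<close>; if \<open>\<ell>\<^sup>n\<close> divides \<open>f\<close>, then \<open>\<ell>\<^sup>n\<^sup>+\<^sup>1\<close>
  divides \<open>m g\<close> and hence \<open>g\<close>. So every power of \<open>\<ell>\<close> would divide all of \<open>I\<^sub>d\<close>, which is nonzero.
\<close>

lemma mult_map_not_inj:
  assumes uv: "u \<noteq> 0 \<or> v \<noteq> 0"
    and nz: "I \<inter> forms (Suc d) \<noteq> {0}"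
    and cf: "common_factor (line_through u v) (I \<inter> forms (Suc d))"
  shows "\<not> inj_on (mult_map I (line_through u v)) (quot_component I d)"
proof
  let ?L = "line_through u v"
  assume "inj_on (mult_map I ?L) (quot_component I d)"
  then have inj: "f \<in> I" if "f \<in> forms d" "?L * f \<in> I" for f
    using that by (simp add: mult_map_inj_iff)
  have L0: "?L \<noteq> 0" using uv by (auto simp: line_through_eq_0_iff)
  have div: "\<exists>f \<in> I \<inter> forms d. g = ?L * f" if g: "g \<in> I" "g \<in> forms (Suc d)" for g
  proof -
    have "eval_at u v g = 0"
      using cf g line_through_dvd_form_iff[OF g(2) uv] by (simp add: common_factor_def)
    then obtain f where "f \<in> forms d" "g = ?L * f"
      using line_through_dvd_obtains[OF g(2) uv] by blast
    then show ?thesis using inj g(1) by blast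
  qed
  obtain m where m: "m \<in> forms 1" "eval_at u v m \<noteq> 0"
  proof (cases "u = 0")
    case True
    then show thesis
      using that[of "line_through 1 0"] uv line_through_in_forms by (auto simp: eval_at_line_through)
  next
    case False
    then show thesis
      using that[of "line_through 0 1"] line_through_in_forms by (auto simp: eval_at_line_through)
  qed
  have pow: "?L ^ n dvd g" if "g \<in> I" "g \<in> forms d" for n g
    using that
  proof (induction n arbitrary: g)
    case (Suc n)
    have "m * g \<in> I" "m * g \<in> forms (Suc d)"
      using ideal_closed(3)[OF Suc.prems(1)] forms_mult[OF m(1) Suc.prems(2)] by simp_all
    then obtain f where f: "f \<in> I" "f \<in> forms d" "m * g = ?L * f" using div by blast
    then have "?L ^ Suc n dvd m * g" using Suc.IH[of f] by simp
    then show ?case using line_through_power_dvd_cancel[OF uv m Suc.prems(2)] by blast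
  qed simp
  obtain g where "g \<in> I" "g \<in> forms (Suc d)" "g \<noteq> 0"
    using nz ideal_closed(1) zero_in_forms by blast
  then obtain f where f: "f \<in> I" "f \<in> forms d" "f \<noteq> 0" using div by fastforce
  have "?L ^ n \<in> forms n" for n
    using forms_mult[OF line_through_in_forms] const_in_forms[of 1]
    by (induction n) (auto simp: pCons_one)
  then have "total_degree (?L ^ Suc d) = Suc d"
    using total_degree_form L0 by (metis power_not_zero)
  moreover have "total_degree (?L ^ Suc d) \<le> d"
    using factor_of_form_total_degree(2)[OF pow[OF f(1,2)] f(2,3)] .
  ultimately show False by simp
qed

end


section \<open>The degree of the greatest common divisor\<close>

definition constants :: "'k::field poly poly set"
  where "constants = range (\<lambda>c. [:[:c:]:])"

lemma subfield_constants: "subfield (constants :: 'k::field poly poly set) kxy"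
proof -
  interpret ring_hom_ring "ring_of_type_algebra :: 'k ring" kxy "\<lambda>c. [:[:c:]:]"
    by (intro ring_hom_ringI2 ring_from_type_algebra ring_hom_memI)
      (simp_all add: ring_of_type_algebra_def pCons_one)
  have "subfield (carrier (ring_of_type_algebra :: 'k ring)) ring_of_type_algebra"
    by (intro field.carrier_is_subfield field_from_type_algebra)
  from img_is_subfield(2)[OF this] show ?thesis
    by (simp add: constants_def ring_of_type_algebra_def)
qed

lemma Span_monomials:
  assumes "set bs \<subseteq> {..i}"
  shows "ring.Span kxy constants (map (\<lambda>b. monom (monom 1 (i - b)) b) bs)
    = {p \<in> forms i. \<forall>b. Polynomial.coeff p b \<noteq> 0 \<longrightarrow> b \<in> set bs}"
  using assms
proof (induction bs)
  case Nil
  have "p = 0" if "\<forall>b. Polynomial.coeff p b = 0" for p :: "'a poly poly"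
    using that by (intro poly_eqI) simp
  then show ?case by (auto simp: ring.Span.simps[OF ring_kxy] zero_in_forms)
next
  case (Cons b bs)
  let ?m = "\<lambda>b. monom (monom 1 (i - b)) b :: 'a poly poly"
  let ?V = "\<lambda>bs. {p \<in> forms i. \<forall>b. Polynomial.coeff p b \<noteq> 0 \<longrightarrow> b \<in> set bs}"
  have b: "b \<le> i" using Cons.prems by simp
  have "ring.Span kxy constants (map ?m (b # bs))
      = ring.line_extension kxy constants (?m b) (?V bs)"
    using Cons by (simp add: ring.Span.simps[OF ring_kxy])
  also have "\<dots> = {monom (monom c (i - b)) b + q | c q. q \<in> ?V bs}"
    unfolding set_eq_iff ring.line_extension_mem_iff[OF ring_kxy] constants_def bex_simps
    by (simp add: smult_monom) blast
  also have "\<dots> = ?V (b # bs)"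
  proof (intro equalityI subsetI)
    fix p assume "p \<in> {monom (monom c (i - b)) b + q | c q. q \<in> ?V bs}"
    then obtain c q where p: "p = monom (monom c (i - b)) b + q" "q \<in> ?V bs" by blast
    moreover have "monom (monom c (i - b)) b \<in> forms i"
      using monom_in_forms[of c "i - b" b] b by simp
    ultimately show "p \<in> ?V (b # bs)" by (auto simp: forms_add)
  next
    fix p assume p: "p \<in> ?V (b # bs)"
    define c where "c = Polynomial.coeff (Polynomial.coeff p b) (i - b)"
    define q where "q = p - monom (monom c (i - b)) b"
    have "monom (monom c (i - b)) b \<in> forms i"
      using monom_in_forms[of c "i - b" b] b by simp
    then have "q \<in> forms i" using p by (auto simp: q_def intro: forms_diff)
    moreover have "Polynomial.coeff p b = monom c (i - b)"
      using coeff_form[of p i b] p b by (simp add: c_def)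
    then have "Polynomial.coeff q b' \<noteq> 0 \<longrightarrow> b' \<in> set bs" for b'
      using p by (auto simp: q_def)
    ultimately have "q \<in> ?V bs" by blast
    moreover have "p = monom (monom c (i - b)) b + q" by (simp add: q_def)
    ultimately show "p \<in> {monom (monom c (i - b)) b + q | c q. q \<in> ?V bs}" by blast
  qed
  finally show ?case .
qed

context
  fixes I :: "'k::field poly poly set"
  assumes I: "ideal I kxy" and proper: "1 \<notin> I"
begin

lemma quot_scalars_eq: "quot_scalars I = (\<lambda>p. I +>\<^bsub>kxy\<^esub> p) ` constants"
  by (simp add: quot_scalars_def constants_def image_image)

lemma quot_hom: "ring_hom_ring kxy (kxy Quot I) (\<lambda>p. I +>\<^bsub>kxy\<^esub> p)"
  by (rule ideal.rcos_ring_hom_ring[OF I])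

lemma subfield_quot_scalars: "subfield (quot_scalars I) (kxy Quot I)"
proof -
  have "I +>\<^bsub>kxy\<^esub> 1 \<noteq> I +>\<^bsub>kxy\<^esub> 0"
    using proper by (simp add: coset_eq_iff[OF I])
  moreover have "I +>\<^bsub>kxy\<^esub> 0 = I"
    using ring.a_rcos_zero[OF ring_kxy I, of 0] ideal_closed(1)[OF I] by simp
  ultimately have "\<one>\<^bsub>kxy Quot I\<^esub> \<noteq> \<zero>\<^bsub>kxy Quot I\<^esub>"
    by (simp add: FactRing_def)
  then show ?thesis
    using ring_hom_ring.img_is_subfield(2)[OF quot_hom subfield_constants]
    by (simp add: quot_scalars_eq)
qed

lemma coset_in_carrier: "I +>\<^bsub>kxy\<^esub> p \<in> carrier (kxy Quot I)"
  using ring_hom_closed[OF ideal.rcos_ring_hom[OF I], of p] by simp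

lemma Span_monomial_cosets:
  assumes "set bs \<subseteq> {..i}"
  shows "ring.Span (kxy Quot I) (quot_scalars I) (map (\<lambda>b. I +>\<^bsub>kxy\<^esub> monom (monom 1 (i - b)) b) bs)
    = (\<lambda>p. I +>\<^bsub>kxy\<^esub> p) ` {p \<in> forms i. \<forall>b. Polynomial.coeff p b \<noteq> 0 \<longrightarrow> b \<in> set bs}"
  using ring_hom_ring.Span_hom[OF quot_hom, of constants "map (\<lambda>b. monom (monom 1 (i - b)) b) bs"]
  by (simp add: Span_monomials[OF assms] quot_scalars_eq comp_def)

lemma finite_dimension_quot_component:
  "ring.finite_dimension (kxy Quot I) (quot_scalars I) (quot_component I i)"
proof -
  have "quot_component I i = ring.Span (kxy Quot I) (quot_scalars I)
      (map (\<lambda>b. I +>\<^bsub>kxy\<^esub> monom (monom 1 (i - b)) b) [0..<Suc i])"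
    using degree_form_le[of _ i] le_degree
    by (subst Span_monomial_cosets) (force simp: quot_component_def)+
  then show ?thesis
    using coset_in_carrier
    by (auto intro!: ring.Span_finite_dimension[OF ideal.quotient_is_ring[OF I] subfield_quot_scalars]
        simp del: ring.Span.simps[OF ideal.quotient_is_ring[OF I]])
qed

text \<open>
  The multiples of \<open>F\<close> in degree \<open>i\<close> have the form \<open>F h\<close> with \<open>h\<close> a form of degree \<open>i - e\<close>, so
  unless they vanish, their degree in \<open>y\<close> lies between \<open>deg\<^sub>y F\<close> and \<open>deg\<^sub>y F + (i - e)\<close>. A nonzero
  combination of monomials whose exponents of \<open>y\<close> avoid this range is therefore no multiple of
  \<open>F\<close>, and cannot lie in \<open>I\<close>.
\<close>

lemma independent_monomial_cosets:
  assumes F: "F \<in> forms e" "F \<noteq> 0" "e \<le> i" and cf: "common_factor F (I \<inter> forms i)"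
    and "distinct bs" "set bs \<subseteq> {..i} - {Polynomial.degree F..Polynomial.degree F + (i - e)}"
  shows "ring.independent (kxy Quot I) (quot_scalars I)
    (map (\<lambda>b. I +>\<^bsub>kxy\<^esub> monom (monom 1 (i - b)) b) bs)"
  using assms(5,6)
proof (induction bs)
  case Nil
  then show ?case by (simp add: ring.li_Nil[OF ideal.quotient_is_ring[OF I]])
next
  case (Cons b bs)
  let ?m = "monom (monom 1 (i - b)) b :: 'k poly poly"
  have m: "?m \<in> forms i"
    using monom_in_forms[of 1 "i - b" b] Cons.prems(2) by simp
  have "I +>\<^bsub>kxy\<^esub> ?m \<notin> ring.Span (kxy Quot I) (quot_scalars I)
      (map (\<lambda>b. I +>\<^bsub>kxy\<^esub> monom (monom 1 (i - b)) b) bs)"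
  proof
    assume "I +>\<^bsub>kxy\<^esub> ?m \<in> ring.Span (kxy Quot I) (quot_scalars I)
      (map (\<lambda>b. I +>\<^bsub>kxy\<^esub> monom (monom 1 (i - b)) b) bs)"
    moreover have "set bs \<subseteq> {..i}" using Cons.prems(2) by auto
    ultimately obtain q where q: "q \<in> forms i"
      "\<And>b'. Polynomial.coeff q b' \<noteq> 0 \<Longrightarrow> b' \<in> set bs" "?m - q \<in> I"
      by (auto simp: Span_monomial_cosets coset_eq_iff[OF I])
    define g where "g = ?m - q"
    have g: "g \<in> I \<inter> forms i" using q m by (simp add: g_def forms_diff)
    have "Polynomial.coeff q b = 0" using q(2)[of b] Cons.prems(1) by auto
    then have "Polynomial.coeff g b \<noteq> 0" by (simp add: g_def)
    then have g0: "g \<noteq> 0" by auto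
    have "b' \<in> set (b # bs)" if "Polynomial.coeff g b' \<noteq> 0" for b'
      using that q(2)[of b'] by (auto simp: g_def split: if_splits)
    then have deg: "Polynomial.degree g \<in> set (b # bs)"
      using g0 leading_coeff_neq_0 by blast
    obtain h where h: "g = F * h" using cf g by (auto simp: common_factor_def elim: dvdE)
    have "h \<in> forms (i - e)"
      using quotient_of_forms[of F h e "i - e"] F g h by simp
    moreover have "Polynomial.degree g = Polynomial.degree F + Polynomial.degree h"
      using g0 h by (auto simp: degree_mult_eq)
    ultimately have "Polynomial.degree g \<in> {Polynomial.degree F..Polynomial.degree F + (i - e)}"
      using degree_form_le by simp
    then show False using deg Cons.prems(2) by blast
  qed
  then show ?case
    using Cons coset_in_carrier[of ?m]
    by (auto intro: ring.li_Cons[OF ideal.quotient_is_ring[OF I]])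
qed

text \<open>
  Of the \<open>i + 1\<close> exponents of \<open>y\<close> in degree \<open>i\<close>, the range excluded above takes \<open>i - e + 1\<close>, since
  \<open>deg\<^sub>y F \<le> e\<close>. This leaves \<open>e\<close> independent classes.
\<close>

lemma common_factor_degree_le_h_vector:
  assumes F: "F \<in> forms e" "F \<noteq> 0" "e \<le> i" and cf: "common_factor F (I \<inter> forms i)"
  shows "e \<le> h_vector I i"
proof -
  interpret Q: ring "kxy Quot I" by (rule ideal.quotient_is_ring[OF I])
  define B where "B = {..i} - {Polynomial.degree F..Polynomial.degree F + (i - e)}"
  have "card B = e"
    using degree_form_le[OF F(1)] F(3) unfolding B_def by (subst card_Diff_subset) auto
  obtain bs where bs: "set bs = B" "distinct bs"
    using finite_distinct_list[of B] by (auto simp: B_def)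
  let ?Us = "map (\<lambda>b. I +>\<^bsub>kxy\<^esub> monom (monom 1 (i - b)) b) bs"
  have "set ?Us \<subseteq> quot_component I i"
  proof
    fix U assume "U \<in> set ?Us"
    then obtain b where b: "b \<le> i" "U = I +>\<^bsub>kxy\<^esub> monom (monom 1 (i - b)) b"
      by (auto simp: bs(1) B_def)
    then show "U \<in> quot_component I i"
      using monom_in_forms[of 1 "i - b" b] by (auto simp: quot_component_def)
  qed
  moreover have "Q.dimension (h_vector I i) (quot_scalars I) (quot_component I i)"
    using Q.finite_dimensionE[OF subfield_quot_scalars finite_dimension_quot_component]
    by (simp add: h_vector_def over_def)
  moreover have "Q.independent (quot_scalars I) ?Us"
    using independent_monomial_cosets[OF assms bs(2)] bs(1) by (simp add: B_def)
  ultimately have "length ?Us \<le> h_vector I i"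
    using Q.independent_length_le_dimension[OF subfield_quot_scalars] by blast
  then show ?thesis
    using bs \<open>card B = e\<close> distinct_card[OF bs(2)] by simp
qed

end


section \<open>Failure of maximal rank\<close>

theorem lemma6p1:
  fixes I :: "'k::{alg_closed_field, field_char_0} poly poly set" and i :: nat
  assumes "graded_ideal I"
    and "artinian_ring (kxy Quot I)"
    and "i \<ge> 1"
  shows "((\<exists>l\<in>forms 1. l \<noteq> 0 \<and>
            \<not> has_maximal_rank (mult_map I l) (quot_component I (i - 1)) (quot_component I i))
          \<longleftrightarrow> (I \<inter> forms i \<noteq> {0} \<and>
               (\<exists>F. total_degree F > 0 \<and> common_factor F (I \<inter> forms i))))
       \<and> (I \<inter> forms i \<noteq> {0} \<and>
             (\<exists>F. total_degree F > 0 \<and> common_factor F (I \<inter> forms i))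
          \<longrightarrow> (\<exists>F. is_gcd_of F (I \<inter> forms i)) \<and>
              (\<forall>F. is_gcd_of F (I \<inter> forms i) \<longrightarrow> total_degree F \<le> h_vector I i))"
proof -
  have I: "ideal I kxy" using assms(1) by (simp add: graded_ideal_def)
  obtain d where i: "i = Suc d" using assms(3) by (cases i) auto
  let ?S = "I \<inter> forms i"
  have S0: "0 \<in> ?S" by (simp add: ideal_closed(1)[OF I] zero_in_forms)
  have factor_form: "F \<in> forms (total_degree F) \<and> F \<noteq> 0 \<and> total_degree F \<le> i"
    if nz: "?S \<noteq> {0}" and cf: "common_factor F ?S" for F
  proof -
    obtain f where "f \<in> ?S" "f \<noteq> 0" using nz S0 by blast
    then show ?thesis
      using factor_of_form_total_degree[of F f i] cf by (auto simp: common_factor_def)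
  qed
  have only_if: "?S \<noteq> {0} \<and> (\<exists>F. total_degree F > 0 \<and> common_factor F ?S)"
    if l: "l \<in> forms 1" "l \<noteq> 0"
      and fail: "\<not> has_maximal_rank (mult_map I l) (quot_component I (i - 1)) (quot_component I i)" for l
  proof -
    obtain u v where uv: "l = line_through u v"
      using linear_form_eq_line_through[OF l(1)] .
    then have uv0: "u \<noteq> 0 \<or> v \<noteq> 0" using l(2) by (simp add: line_through_eq_0_iff)
    have cf: "common_factor l ?S"
      using fail mult_map_surj_iff_line[OF I uv0, of d] by (auto simp: has_maximal_rank_def uv i)
    obtain f where f: "f \<in> forms d" "l * f \<in> I" "f \<notin> I"
      using fail by (auto simp: has_maximal_rank_def mult_map_inj_iff[OF I] i)
    then have "l * f \<in> ?S" "l * f \<noteq> 0"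
      using forms_mult[OF l(1) f(1)] l(2) ideal_closed(1)[OF I] by (auto simp: i)
    then have "?S \<noteq> {0}" by blast
    moreover have "total_degree l > 0" using total_degree_form[OF l] by simp
    ultimately show ?thesis using cf by blast
  qed
  have if_part: "\<exists>l\<in>forms 1. l \<noteq> 0 \<and>
      \<not> has_maximal_rank (mult_map I l) (quot_component I (i - 1)) (quot_component I i)"
    if nz: "?S \<noteq> {0}" and F: "total_degree F > 0" "common_factor F ?S" for F
  proof -
    have Ff: "F \<in> forms (total_degree F)" using factor_form[OF nz F(2)] by blast
    obtain u v where uv: "u \<noteq> 0 \<or> v \<noteq> 0" "eval_at u v F = 0"
      using form_has_zero[OF Ff F(1)] .
    have "line_through u v dvd F" using line_through_dvd_form[OF Ff uv(2,1)] .
    then have "common_factor (line_through u v) ?S"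
      using F(2) by (auto simp: common_factor_def intro: dvd_trans)
    then have "\<not> has_maximal_rank (mult_map I (line_through u v)) (quot_component I (i - 1)) (quot_component I i)"
      using mult_map_surj_iff_line[OF I uv(1), of d] mult_map_not_inj[OF I uv(1), of d] nz
      by (simp add: has_maximal_rank_def i)
    moreover have "line_through u v \<noteq> 0" using uv(1) by (auto simp: line_through_eq_0_iff)
    ultimately show ?thesis using line_through_in_forms by blast
  qed
  have degree_bound: "total_degree F \<le> h_vector I i"
    if nz: "?S \<noteq> {0}" and cf: "common_factor F ?S" for F
  proof (cases "total_degree F = 0")
    case False
    have Ff: "F \<in> forms (total_degree F)" "F \<noteq> 0" "total_degree F \<le> i"
      using factor_form[OF nz cf] by auto
    obtain u v where uv: "u \<noteq> 0 \<or> v \<noteq> 0" "eval_at u v F = 0"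
      using form_has_zero[OF Ff(1)] False by auto
    \<comment> \<open>If \<open>I\<close> were the whole ring, \<open>F\<close> would divide \<open>x\<^sup>i\<close> and \<open>y\<^sup>i\<close>, which have no common zero.\<close>
    have "1 \<notin> I"
    proof
      assume "1 \<in> I"
      then have UN: "p \<in> I" for p using ideal_closed(3)[OF I, of 1 p] by simp
      have "F dvd monom (monom 1 i) 0" "F dvd monom (monom 1 0) i"
        using cf UN monom_in_forms[of 1 i 0] monom_in_forms[of 1 0 i] by (auto simp: common_factor_def)
      then have "eval_at u v (monom (monom 1 i) 0) = 0" "eval_at u v (monom (monom 1 0) i) = 0"
        using uv(2) by (metis dvdE eval_at_simps(4) mult_zero_left)+
      then show False using uv(1) by simp
    qed
    then show ?thesis
      using common_factor_degree_le_h_vector[OF I _ Ff cf] by blast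
  qed simp
  have "\<exists>F. is_gcd_of F ?S" if "?S \<noteq> {0}"
    using gcd_of_forms_exists[of ?S i] that S0 by blast
  then show ?thesis
    using only_if if_part degree_bound unfolding is_gcd_of_def by blast
qed

end
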